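(* Let $\alpha,\beta>-1$, $p,\gamma_+,\gamma_-\in\mathbb N_0$, $d=2p+\gamma_++\gamma_-$, $N\ge1$, and let $s_i=[a_i,b_i]\subset(-1,1)$, $i=1,\ldots,N$. Define the classical Jacobi cell moments $\mathcal J_i(n)=\int_{s_i}P_n^{(\alpha,\beta)}(x)\,\omega_{\alpha,\beta}(x)\,dx$, $n\ge0$, and the generalized Jacobi moment matrix $\mathcal M_N\in\mathbb R^{N\times N}$ by $$[\mathcal M_N]_{i,k+1}=\int_{s_i}\mathcal Q_k(x)\,\chi(x)\,\omega_{\alpha,\beta}(x)\,dx,\quad i=1,\ldots,N,\ k=0,\ldots,N-1.$$ Then for all $i=1,\ldots,N$ and $k=0,\ldots,N-1$, $$[\mathcal M_N]_{i,k+1}=\sum_{j=0}^{d}a_{k,j}\,\mathcal J_i(k+j).$$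
   Context: $\omega_{\alpha,\beta}(x)=(1-x)^\alpha(1+x)^\beta$ and $\chi(x)=x^{2p}(1-x)^{\gamma_+}(1+x)^{\gamma_-}$; the generalized Jacobi weight is $\chi\,\omega_{\alpha,\beta}$. $P_n^{(\alpha,\beta)}$ is the Jacobi polynomial of degree $n$ normalized by $P_n^{(\alpha,\beta)}(1)=\frac{(\alpha+1)_n}{n!}$ ($(s)_n$ the rising factorial), with leading coefficient $\kappa_n^{(\alpha,\beta)}\ne0$. For $k\ge0$, the polynomial $\mathcal N_k(x)=\sum_{j=0}^d a_{k,j}P_{k+j}^{(\alpha,\beta)}(x)$ is the one with $a_{k,d}=(-1)^{\gamma_+}/\kappa_{k+d}^{(\alpha,\beta)}$ and whose remaining coefficients $a_{k,0},\ldots,a_{k,d-1}$ (if $d\ge1$) are uniquely determined by the $d$ conditions $\mathcal N_k^{(r)}(0)=0$ for $r=0,\ldots,2p-1$; $\mathcal N_k^{(r)}(1)=0$ for $r=0,\ldots,\gamma_+-1$; $\mathcal N_k^{(r)}(-1)=0$ for $r=0,\ldots,\gamma_--1$ (conditions with empty range are absent). Then $\mathcal Q_k=\mathcal N_k/\chi$, which is a monic polynomial of degree $k$. *)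

theory Defs
  imports
    "HOL-Analysis.Analysis"
    "HOL-Computational_Algebra.Polynomial"
    "Jordan_Normal_Form.Matrix"
begin

definition jacobi_weight :: "real \<Rightarrow> real \<Rightarrow> real \<Rightarrow> real" where
  "jacobi_weight \<alpha> \<beta> x = (1 - x) powr \<alpha> * (1 + x) powr \<beta>"

(* The hypergeometric form (\<alpha>+1)_n / n! * 2F1(-n, n+\<alpha>+\<beta>+1; \<alpha>+1; (1-x)/2).
   The denominators do not vanish because \<alpha> > -1 throughout. *)
definition jacobi_poly :: "real \<Rightarrow> real \<Rightarrow> nat \<Rightarrow> real poly" where
  "jacobi_poly \<alpha> \<beta> n =
     Polynomial.smult (pochhammer (\<alpha> + 1) n / fact n)
       (\<Sum>m\<le>n. Polynomial.smult (pochhammer (- real n) m * pochhammer (real n + \<alpha> + \<beta> + 1) m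
                        / (pochhammer (\<alpha> + 1) m * fact m))
                 ([:1/2, -1/2:] ^ m))"

lemma poly_jacobi_poly_1: "poly (jacobi_poly \<alpha> \<beta> n) 1 = pochhammer (\<alpha> + 1) n / fact n"
proof -
  have "(\<Sum>m\<le>n. pochhammer (- real n) m * pochhammer (real n + \<alpha> + \<beta> + 1) m
            / (pochhammer (\<alpha> + 1) m * fact m) * (0::real) ^ m) =
        (\<Sum>m\<in>{0}. pochhammer (- real n) m * pochhammer (real n + \<alpha> + \<beta> + 1) m
            / (pochhammer (\<alpha> + 1) m * fact m) * (0::real) ^ m)"
    by (rule sum.mono_neutral_right) auto
  then show ?thesis
    by (simp add: jacobi_poly_def poly_sum)
qed

lemma degree_jacobi_poly:
  assumes "\<alpha> > -1" "\<beta> > -1"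
  shows "degree (jacobi_poly \<alpha> \<beta> n) = n"
proof -
  define c where "c m = pochhammer (- real n) m * pochhammer (real n + \<alpha> + \<beta> + 1) m
                        / (pochhammer (\<alpha> + 1) m * fact m)" for m
  define q :: "real poly" where "q = [:1/2, -1/2:]"
  have dq: "degree (q ^ m) = m" for m
    by (simp add: q_def degree_power_eq)
  have ne: "pochhammer (\<alpha> + 1) m \<noteq> 0" for m
    using assms by (intro pochhammer_pos less_imp_neq[symmetric]) auto
  have "pochhammer (real n + \<alpha> + \<beta> + 1) n \<noteq> 0"
    using assms by (cases n) (auto intro!: pochhammer_pos less_imp_neq[symmetric])
  moreover have "pochhammer (- real n) n \<noteq> 0"
    by (simp add: pochhammer_same)
  ultimately have cn: "c n \<noteq> 0"
    using ne by (simp add: c_def)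
  have top: "degree (Polynomial.smult (c n) (q ^ n)) = n"
    using cn dq by simp
  have "degree (\<Sum>m\<le>n. Polynomial.smult (c m) (q ^ m)) = n"
  proof (cases n)
    case 0
    then show ?thesis by simp
  next
    case (Suc k)
    have "degree (\<Sum>m\<le>k. Polynomial.smult (c m) (q ^ m)) \<le> k"
      by (rule degree_sum_le) (auto intro: order_trans[OF degree_smult_le] simp: dq)
    then have "degree (\<Sum>m\<le>k. Polynomial.smult (c m) (q ^ m)) < degree (Polynomial.smult (c n) (q ^ n))"
      unfolding top using Suc by simp
    then have "degree ((\<Sum>m\<le>k. Polynomial.smult (c m) (q ^ m)) + Polynomial.smult (c n) (q ^ n)) = n"
      using top degree_add_eq_right by metis
    then show ?thesis
      using Suc by (simp add: add.commute)
  qed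
  then show ?thesis
    using ne[of n] unfolding jacobi_poly_def c_def q_def by simp
qed

definition gj_factor :: "nat \<Rightarrow> nat \<Rightarrow> nat \<Rightarrow> real poly" where
  "gj_factor p \<gamma>p \<gamma>m = [:0, 1:] ^ (2 * p) * [:1, -1:] ^ \<gamma>p * [:1, 1:] ^ \<gamma>m"

definition jacobi_comb :: "real \<Rightarrow> real \<Rightarrow> nat \<Rightarrow> nat \<Rightarrow> (nat \<Rightarrow> real) \<Rightarrow> real poly" where
  "jacobi_comb \<alpha> \<beta> d k c = (\<Sum>j=0..d. Polynomial.smult (c j) (jacobi_poly \<alpha> \<beta> (k + j)))"

(* c lists the connection coefficients a_{k,0}, ..., a_{k,d}; entries beyond d are irrelevant. *)
definition gj_connection_coeffs ::
    "real \<Rightarrow> real \<Rightarrow> nat \<Rightarrow> nat \<Rightarrow> nat \<Rightarrow> nat \<Rightarrow> (nat \<Rightarrow> real) \<Rightarrow> bool" where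
  "gj_connection_coeffs \<alpha> \<beta> p \<gamma>p \<gamma>m k c \<longleftrightarrow>
     (let d = 2 * p + \<gamma>p + \<gamma>m; \<N> = jacobi_comb \<alpha> \<beta> d k c in
        c d = (-1) ^ \<gamma>p / lead_coeff (jacobi_poly \<alpha> \<beta> (k + d)) \<and>
        (\<forall>r<2 * p. poly ((pderiv ^^ r) \<N>) 0 = 0) \<and>
        (\<forall>r<\<gamma>p. poly ((pderiv ^^ r) \<N>) 1 = 0) \<and>
        (\<forall>r<\<gamma>m. poly ((pderiv ^^ r) \<N>) (-1) = 0))"

(* Polynomial division; it is exact when c satisfies gj_connection_coeffs, since the
   vanishing conditions make gj_factor divide the numerator. *)
definition gj_poly ::
    "real \<Rightarrow> real \<Rightarrow> nat \<Rightarrow> nat \<Rightarrow> nat \<Rightarrow> nat \<Rightarrow> (nat \<Rightarrow> real) \<Rightarrow> real poly" where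
  "gj_poly \<alpha> \<beta> p \<gamma>p \<gamma>m k c =
     jacobi_comb \<alpha> \<beta> (2 * p + \<gamma>p + \<gamma>m) k c div gj_factor p \<gamma>p \<gamma>m"

definition jacobi_cell_moment :: "real \<Rightarrow> real \<Rightarrow> real \<Rightarrow> real \<Rightarrow> nat \<Rightarrow> real" where
  "jacobi_cell_moment \<alpha> \<beta> l u n =
     integral {l..u} (\<lambda>x. poly (jacobi_poly \<alpha> \<beta> n) x * jacobi_weight \<alpha> \<beta> x)"

(* Cells are numbered 1, ..., N, whereas matrix entries are addressed from 0: the entry in
   row i and column k + 1 of the moment matrix is the one at index (i - 1, k). *)
definition gj_moment_matrix ::
    "real \<Rightarrow> real \<Rightarrow> nat \<Rightarrow> nat \<Rightarrow> nat \<Rightarrow> (nat \<Rightarrow> nat \<Rightarrow> real) \<Rightarrow>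
     (nat \<Rightarrow> real) \<Rightarrow> (nat \<Rightarrow> real) \<Rightarrow> nat \<Rightarrow> real Matrix.mat" where
  "gj_moment_matrix \<alpha> \<beta> p \<gamma>p \<gamma>m a l u N =
     Matrix.mat N N (\<lambda>(r, k). integral {l (Suc r)..u (Suc r)}
       (\<lambda>x. poly (gj_poly \<alpha> \<beta> p \<gamma>p \<gamma>m k (a k)) x * poly (gj_factor p \<gamma>p \<gamma>m) x
            * jacobi_weight \<alpha> \<beta> x))"

end

theory Submission
  imports
    Defs
    "HOL-Computational_Algebra.Field_as_Ring"
    "HOL-Computational_Algebra.Polynomial_Factorial"
begin

text \<open>
  The vanishing conditions on the combination \<open>\<N>\<close> of Jacobi polynomials say exactly that it has
  zeros of order at least \<open>2 * p\<close>, \<open>\<gamma>p\<close> and \<open>\<gamma>m\<close> at \<open>0\<close>, \<open>1\<close> and \<open>-1\<close>.  Because these points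
  are distinct, the corresponding powers of linear factors are pairwise coprime, so their product
  \<open>\<chi>\<close> divides \<open>\<N>\<close> (\<open>gj_factor_dvd_jacobi_comb\<close>).  The division defining the quotient polynomial
  is therefore exact, and multiplying by \<open>\<chi>\<close> under the integral restores \<open>\<N>\<close>, against the
  classical weight.  What is left is linearity of the integral, which applies because
  the cells stay away from \<open>\<plusminus>1\<close>, so that the classical weight is continuous on them.
\<close>

text \<open>
  In characteristic zero, differentiation lowers the order of a root by exactly one, so each
  further vanishing derivative forces one more linear factor.
\<close>

lemma linear_power_dvd_if_derivs_vanish:
  fixes f :: "'a :: field_char_0 poly"
  assumes "\<And>r. r < n \<Longrightarrow> poly ((pderiv ^^ r) f) x = 0"
  shows "[:-x, 1:] ^ n dvd f"
  using assms
proof (induction n arbitrary: f)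
  case 0
  show ?case by simp
next
  case (Suc n)
  have root: "poly f x = 0"
    using Suc.prems[of 0] by simp
  have "poly ((pderiv ^^ r) (pderiv f)) x = 0" if "r < n" for r
    using Suc.prems[of "Suc r"] that by (simp add: funpow_Suc_right del: funpow.simps)
  then have dvd: "[:-x, 1:] ^ n dvd pderiv f"
    by (rule Suc.IH)
  show ?case
  proof (cases "pderiv f = 0")
    case True
    \<comment> \<open>The order of a zero derivative is meaningless; but \<open>f\<close> is then constant, hence zero.\<close>
    then obtain c where "f = [:c:]"
      using pderiv_iszero by blast
    with root show ?thesis by simp
  next
    case False
    then have "f \<noteq> 0" by auto
    then have "order x f = Suc (order x (pderiv f))"
      using root by (rule order_pderiv)
    moreover have "n \<le> order x (pderiv f)"
      using dvd False order_divides by blast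
    ultimately show ?thesis
      by (metis Suc_le_mono order_divides)
  qed
qed

lemma coprime_linear_polys:
  fixes x y :: "'a :: field"
  assumes "x \<noteq> y"
  shows "coprime [:-x, 1:] [:-y, 1:]"
proof (rule coprimeI)
  fix c assume "c dvd [:-x, 1:]" "c dvd [:-y, 1:]"
  then have "c dvd [:-x, 1:] - [:-y, 1:]"
    by (rule dvd_diff)
  then have "c dvd [:y - x:]" by simp
  moreover have "[:y - x:] dvd 1"
    using assms by (simp add: is_unit_pCons_iff)
  ultimately show "is_unit c"
    by (rule dvd_trans)
qed

lemma gj_factor_dvd_jacobi_comb:
  assumes "gj_connection_coeffs \<alpha> \<beta> p \<gamma>p \<gamma>m k c"
  shows "gj_factor p \<gamma>p \<gamma>m dvd jacobi_comb \<alpha> \<beta> (2 * p + \<gamma>p + \<gamma>m) k c"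
proof -
  let ?N = "jacobi_comb \<alpha> \<beta> (2 * p + \<gamma>p + \<gamma>m) k c"
  have "[:-0, 1:] ^ (2 * p) dvd ?N" "[:-1, 1:] ^ \<gamma>p dvd ?N" "[:-(-1), 1:] ^ \<gamma>m dvd ?N"
    using assms unfolding gj_connection_coeffs_def Let_def
    by (intro linear_power_dvd_if_derivs_vanish; blast)+
  moreover have
    "coprime ([:-0, 1:] ^ (2 * p)) ([:-1, 1:] ^ \<gamma>p :: real poly)"
    "coprime ([:-0, 1:] ^ (2 * p) * [:-1, 1:] ^ \<gamma>p) ([:-(-1), 1:] ^ \<gamma>m :: real poly)"
    unfolding coprime_mult_left_iff
    by (intro conjI coprime_power_left_iff[THEN iffD2] coprime_power_right_iff[THEN iffD2]
          disjI1 coprime_linear_polys; simp)+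
  ultimately have "[:-0, 1:] ^ (2 * p) * [:-1, 1:] ^ \<gamma>p * [:-(-1), 1:] ^ \<gamma>m dvd ?N"
    by (intro divides_mult)
  \<comment> \<open>The factor at \<open>1\<close> enters \<open>\<chi>\<close> as \<open>1 - x\<close>, which differs from \<open>x - 1\<close> by a unit.\<close>
  moreover have "[:1, -1:] ^ \<gamma>p = Polynomial.smult ((-1) ^ \<gamma>p) ([:-1, 1:] ^ \<gamma>p :: real poly)"
    by (simp flip: smult_power)
  ultimately show ?thesis
    by (simp add: gj_factor_def smult_dvd_iff)
qed

lemma integrable_poly_jacobi_weight:
  assumes "{l..u} \<subseteq> {-1<..<1}"
  shows "(\<lambda>x. poly f x * jacobi_weight \<alpha> \<beta> x) integrable_on {l..u}"
  unfolding jacobi_weight_def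
  using assms by (intro integrable_continuous_real continuous_intros) fastforce+

lemma integral_jacobi_comb:
  assumes "{l..u} \<subseteq> {-1<..<1}"
  shows "integral {l..u} (\<lambda>x. poly (jacobi_comb \<alpha> \<beta> d k c) x * jacobi_weight \<alpha> \<beta> x) =
    (\<Sum>j=0..d. c j * jacobi_cell_moment \<alpha> \<beta> l u (k + j))"
proof -
  have "integral {l..u} (\<lambda>x. poly (jacobi_comb \<alpha> \<beta> d k c) x * jacobi_weight \<alpha> \<beta> x) =
    integral {l..u} (\<lambda>x. \<Sum>j=0..d. c j * (poly (jacobi_poly \<alpha> \<beta> (k + j)) x * jacobi_weight \<alpha> \<beta> x))"
    by (simp add: jacobi_comb_def poly_sum sum_distrib_right mult.assoc)
  also have "\<dots> = (\<Sum>j=0..d. integral {l..u}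
      (\<lambda>x. c j * (poly (jacobi_poly \<alpha> \<beta> (k + j)) x * jacobi_weight \<alpha> \<beta> x)))"
    by (intro integral_sum integrable_on_mult_right integrable_poly_jacobi_weight assms) simp
  finally show ?thesis
    by (simp add: jacobi_cell_moment_def)
qed

theorem proposition6:
  fixes \<alpha> \<beta> :: real and p \<gamma>p \<gamma>m d N :: nat
    and a :: "nat \<Rightarrow> nat \<Rightarrow> real" and l u :: "nat \<Rightarrow> real"
  assumes "\<alpha> > -1" and "\<beta> > -1"
    and "d = 2 * p + \<gamma>p + \<gamma>m"
    and "N \<ge> 1"
    and "\<And>k. gj_connection_coeffs \<alpha> \<beta> p \<gamma>p \<gamma>m k (a k)"
    and "\<And>i. i \<in> {1..N} \<Longrightarrow> l i \<le> u i \<and> {l i..u i} \<subseteq> {-1<..<1}"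
  shows "\<forall>i\<in>{1..N}. \<forall>k\<in>{0..N - 1}.
    gj_moment_matrix \<alpha> \<beta> p \<gamma>p \<gamma>m a l u N $$ (i - 1, k) =
      (\<Sum>j=0..d. a k j * jacobi_cell_moment \<alpha> \<beta> (l i) (u i) (k + j))"
proof (intro ballI)
  fix i k assume i: "i \<in> {1..N}" and "k \<in> {0..N - 1}"
  then have "i - 1 < N" "k < N" by auto
  have "gj_poly \<alpha> \<beta> p \<gamma>p \<gamma>m k (a k) * gj_factor p \<gamma>p \<gamma>m = jacobi_comb \<alpha> \<beta> d k (a k)"
    unfolding gj_poly_def assms(3)
    by (intro dvd_div_mult_self gj_factor_dvd_jacobi_comb assms(5))
  then have exact: "poly (gj_poly \<alpha> \<beta> p \<gamma>p \<gamma>m k (a k)) x * poly (gj_factor p \<gamma>p \<gamma>m) x =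
      poly (jacobi_comb \<alpha> \<beta> d k (a k)) x" for x
    by (metis poly_mult)
  have "gj_moment_matrix \<alpha> \<beta> p \<gamma>p \<gamma>m a l u N $$ (i - 1, k) =
      integral {l i..u i} (\<lambda>x. poly (jacobi_comb \<alpha> \<beta> d k (a k)) x * jacobi_weight \<alpha> \<beta> x)"
    using i \<open>i - 1 < N\<close> \<open>k < N\<close> by (simp add: gj_moment_matrix_def exact)
  also have "\<dots> = (\<Sum>j=0..d. a k j * jacobi_cell_moment \<alpha> \<beta> (l i) (u i) (k + j))"
    using assms(6)[OF i] by (intro integral_jacobi_comb) simp
  finally show "gj_moment_matrix \<alpha> \<beta> p \<gamma>p \<gamma>m a l u N $$ (i - 1, k) =
      (\<Sum>j=0..d. a k j * jacobi_cell_moment \<alpha> \<beta> (l i) (u i) (k + j))" .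
qed

end
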